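(* Let $m$ be a positive integer and let $n_1,\ldots,n_{m}$ be positive integers; set $n_{m+1}=n_1$. Then for any non-negative integers $a$, $j$ and $r$ with $a\leqslant n_1$ and $j\leqslant m$, the expression $$ \frac{1}{[n_m+a]}{n_1+n_{m}\brack n_1-a}^{-1} \sum_{k=a}^{n_1}[2k][k]^{2r}q^{jk^2-(r+1)k}\prod_{i=1}^{m} {n_i+n_{i+1}\brack n_i+k} $$ is a Laurent polynomial in $q$ with integer coefficients.
   Context: $q$ is an indeterminate, $[n]=\frac{1-q^n}{1-q}$, $(q;q)_n=(1-q)\cdots(1-q^n)$ with $(q;q)_0=1$, and ${n\brack k}=\frac{(q;q)_n}{(q;q)_k(q;q)_{n-k}}$ for $0\leqslant k\leqslant n$, $0$ otherwise. *)

theory Defs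
  imports "HOL-Computational_Algebra.Polynomial" "HOL-Computational_Algebra.Fraction_Field"
begin

text \<open>
  The indeterminate lives in the fraction field of \<open>\<int>[q]\<close>, which is the field \<open>\<rat>(q)\<close>.
\<close>

definition qq :: "int poly fract" where
  "qq = Fract [:0, 1:] 1"

definition qint :: "nat \<Rightarrow> int poly fract" where
  "qint n = (1 - qq ^ n) / (1 - qq)"

definition qfact :: "nat \<Rightarrow> int poly fract" where
  "qfact n = (\<Prod>i = 1..n. 1 - qq ^ i)"

definition qbinom :: "nat \<Rightarrow> nat \<Rightarrow> int poly fract" where
  "qbinom n k = (if k \<le> n then qfact n / (qfact k * qfact (n - k)) else 0)"

definition int_laurent_poly :: "int poly fract \<Rightarrow> bool" where
  "int_laurent_poly f \<longleftrightarrow>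
     (\<exists>c :: int \<Rightarrow> int. finite {i. c i \<noteq> 0} \<and> f = (\<Sum>i | c i \<noteq> 0. of_int (c i) * qq powi i))"

end

theory Submission
  imports Defs
begin

text \<open>
  Writing \<open>g\<^sub>x(k) = 1 / ((q)\<^sub>x\<^sub>-\<^sub>k (q)\<^sub>x\<^sub>+\<^sub>k)\<close>, the cyclic product of Gaussian binomials is
  \<open>\<Prod> (q)\<^bsub>n\<^sub>i + n\<^sub>i\<^sub>+\<^sub>1\<^esub> \<cdot> \<Prod> g\<^bsub>n\<^sub>i\<^esub>(k)\<close>. The two forms of the \<open>q\<close>-Vandermonde identity expand
  \<open>g\<^sub>x(k) g\<^sub>y(k)\<close> in the \<open>g\<^sub>l(k)\<close>, one with coefficients independent of \<open>k\<close>, the other with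
  coefficients proportional to \<open>q\<^bsup>-k\<^sup>2\<^esup>\<close>. Merging the first two indices in this way lowers \<open>m\<close> by one,
  and \<open>j\<close> by zero or one, at the cost of factors that are Gaussian binomials. For \<open>m = 1\<close> one
  inducts on \<open>r\<close> by means of \<open>q\<^bsup>-k\<^esup>[k]\<^sup>2 = q\<^bsup>-n\<^esup>([n]\<^sup>2 - [n+k][n-k])\<close>, and the case \<open>r = 0\<close> telescopes.
\<close>

section \<open>Nonvanishing of q-integers and q-factorials\<close>

lemma qq_neq_0 [simp]: "qq \<noteq> 0"
  by (simp add: qq_def Zero_fract_def eq_fract)

lemma qq_power: "qq ^ n = Fract (monom 1 n) 1"
  by (induction n) (simp_all add: qq_def One_fract_def monom_0 monom_Suc flip: one_pCons)

lemma qq_power_eq_1_iff [simp]: "qq ^ n = 1 \<longleftrightarrow> n = 0"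
  by (auto simp: qq_power One_fract_def eq_fract monom_eq_1_iff)

lemma qq_neq_1 [simp]: "qq \<noteq> 1"
  using qq_power_eq_1_iff[of 1] by simp

lemma one_minus_qq_neq_0 [simp]: "1 - qq \<noteq> 0"
  using qq_power_eq_1_iff[of 1] by simp

lemma qfact_0 [simp]: "qfact 0 = 1"
  by (simp add: qfact_def)

lemma qfact_Suc: "qfact (Suc n) = qfact n * (1 - qq ^ Suc n)"
  by (simp add: qfact_def)

lemma qfact_neq_0 [simp]: "qfact n \<noteq> 0"
  by (auto simp: qfact_def)

lemma qint_eq_0_iff: "qint n = 0 \<longleftrightarrow> n = 0"
  by (auto simp: qint_def)

lemma qint_0 [simp]: "qint 0 = 0"
  by (simp add: qint_eq_0_iff)

lemma qfact_rec: "0 < n \<Longrightarrow> qfact n = qfact (n - 1) * ((1 - qq) * qint n)"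
  by (cases n) (simp_all add: qfact_Suc qint_def)

section \<open>Laurent polynomials form a ring\<close>

text \<open>The definition sums over the exact support. Allowing any finite superset lets two sums
  share one index set, which is needed when coefficients cancel in an addition.\<close>

lemma int_laurent_poly_sum_powi:
  fixes c :: "int \<Rightarrow> int"
  assumes "finite A" "\<And>i. i \<notin> A \<Longrightarrow> c i = 0"
  shows "int_laurent_poly (\<Sum>i\<in>A. of_int (c i) * qq powi i)"
proof -
  have sub: "{i. c i \<noteq> 0} \<subseteq> A" using assms(2) by auto
  have "(\<Sum>i\<in>A. of_int (c i) * qq powi i) = (\<Sum>i | c i \<noteq> 0. of_int (c i) * qq powi i)"
    by (rule sum.mono_neutral_right) (use assms(1) sub in auto)
  thus ?thesis unfolding int_laurent_poly_def
    using finite_subset[OF sub assms(1)] by blast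
qed

lemma int_laurent_poly_monom [simp]: "int_laurent_poly (of_int c * qq powi i)"
  using int_laurent_poly_sum_powi[of "{i}" "\<lambda>k. if k = i then c else 0"] by simp

lemma int_laurent_poly_add:
  assumes "int_laurent_poly f" "int_laurent_poly g"
  shows "int_laurent_poly (f + g)"
proof -
  obtain c where c: "finite {i. c i \<noteq> 0}" "f = (\<Sum>i | c i \<noteq> 0. of_int (c i) * qq powi i)"
    using assms(1) unfolding int_laurent_poly_def by auto
  obtain d where d: "finite {i. d i \<noteq> 0}" "g = (\<Sum>i | d i \<noteq> 0. of_int (d i) * qq powi i)"
    using assms(2) unfolding int_laurent_poly_def by auto
  define A where "A = {i. c i \<noteq> 0} \<union> {i. d i \<noteq> 0}"
  have "finite A" using c(1) d(1) by (simp add: A_def)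
  have f: "f = (\<Sum>i\<in>A. of_int (c i) * qq powi i)"
    unfolding c(2) by (rule sum.mono_neutral_left) (use \<open>finite A\<close> in \<open>auto simp: A_def\<close>)
  have g: "g = (\<Sum>i\<in>A. of_int (d i) * qq powi i)"
    unfolding d(2) by (rule sum.mono_neutral_left) (use \<open>finite A\<close> in \<open>auto simp: A_def\<close>)
  have "f + g = (\<Sum>i\<in>A. of_int (c i + d i) * qq powi i)"
    unfolding f g by (simp add: sum.distrib algebra_simps)
  also have "int_laurent_poly \<dots>"
    by (rule int_laurent_poly_sum_powi) (use \<open>finite A\<close> in \<open>auto simp: A_def\<close>)
  finally show ?thesis .
qed

lemma int_laurent_poly_powi [simp]: "int_laurent_poly (qq powi i)"
  using int_laurent_poly_monom[of 1 i] by simp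

lemma int_laurent_poly_power_qq [simp]: "int_laurent_poly (qq ^ n)"
  using int_laurent_poly_powi[of "int n"] by (simp del: int_laurent_poly_powi)

lemma int_laurent_poly_0 [simp]: "int_laurent_poly 0"
  using int_laurent_poly_monom[of 0 0] by (simp del: int_laurent_poly_monom)

lemma int_laurent_poly_1 [simp]: "int_laurent_poly 1"
  using int_laurent_poly_powi[of 0] by (simp del: int_laurent_poly_powi)

lemma int_laurent_poly_sum:
  assumes "\<And>i. i \<in> A \<Longrightarrow> int_laurent_poly (f i)"
  shows "int_laurent_poly (\<Sum>i\<in>A. f i)"
  using assms by (induction A rule: infinite_finite_induct) (auto intro!: int_laurent_poly_add)

lemma int_laurent_poly_mult:
  assumes "int_laurent_poly f" "int_laurent_poly g"
  shows "int_laurent_poly (f * g)"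
proof -
  obtain c where c: "f = (\<Sum>i | c i \<noteq> 0. of_int (c i) * qq powi i)"
    using assms(1) unfolding int_laurent_poly_def by auto
  obtain d where d: "g = (\<Sum>i | d i \<noteq> 0. of_int (d i) * qq powi i)"
    using assms(2) unfolding int_laurent_poly_def by auto
  \<comment> \<open>Closure under sums is already known, so the terms of equal degree need not be
    collected into a convolution.\<close>
  have "f * g = (\<Sum>i | c i \<noteq> 0. \<Sum>k | d k \<noteq> 0. of_int (c i * d k) * qq powi (i + k))"
    unfolding c d sum_product by (intro sum.cong) (simp_all add: power_int_add)
  also have "int_laurent_poly \<dots>"
    by (intro int_laurent_poly_sum int_laurent_poly_monom)
  finally show ?thesis .
qed

lemma int_laurent_poly_uminus:
  assumes "int_laurent_poly f"
  shows "int_laurent_poly (- f)"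
  using int_laurent_poly_mult[OF int_laurent_poly_monom[of "-1" 0] assms] by simp

lemma int_laurent_poly_diff:
  assumes "int_laurent_poly f" "int_laurent_poly g"
  shows "int_laurent_poly (f - g)"
  using int_laurent_poly_add[OF assms(1) int_laurent_poly_uminus[OF assms(2)]] by simp

lemma int_laurent_poly_qint [simp]: "int_laurent_poly (qint n)"
proof -
  have "qint n = (\<Sum>i<n. qq ^ i)"
    unfolding qint_def by (simp add: sum_gp_strict)
  thus ?thesis by (auto intro: int_laurent_poly_sum)
qed

section \<open>Gaussian binomial coefficients\<close>

lemma qbinom_0_right [simp]: "qbinom n 0 = 1"
  by (simp add: qbinom_def)

lemma qbinom_self [simp]: "qbinom n n = 1"
  by (simp add: qbinom_def)

lemma qbinom_eq_0 [simp]: "n < k \<Longrightarrow> qbinom n k = 0"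
  by (simp add: qbinom_def)

lemma qbinom_Suc_Suc:
  "qbinom (Suc n) (Suc k) = qbinom n k + qq ^ Suc k * qbinom n (Suc k)"
proof (cases n k rule: linorder_cases)
  case greater
  then obtain d where d: "n = Suc (d + k)"
    using less_imp_Suc_add by (metis add.commute)
  have "qbinom n k = qfact n / (qfact k * qfact (Suc d))"
    "qbinom n (Suc k) = qfact n / (qfact (Suc k) * qfact d)"
    "qbinom (Suc n) (Suc k) = qfact (Suc n) / (qfact (Suc k) * qfact (Suc d))"
    by (simp_all add: d qbinom_def Suc_diff_le)
  moreover have "1 - qq ^ Suc d \<noteq> 0" "1 - qq ^ Suc k \<noteq> 0"
    by (simp_all del: power_Suc)
  \<comment> \<open>Over the common denominator, the q-Pascal rule reduces to this splitting of 1 -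
    q^(n+1), where n - k = d + 1.\<close>
  moreover have "1 - qq ^ Suc n = (1 - qq ^ Suc k) + qq ^ Suc k * (1 - qq ^ Suc d)"
    by (simp add: d power_add algebra_simps)
  ultimately show ?thesis
    by (simp only: qfact_Suc) (simp add: divide_simps distrib_left mult_ac del: power_Suc)
qed auto

text \<open>The q-Pascal rule builds the quotient of factorials from 0 and 1 without
  division.\<close>

lemma int_laurent_poly_qbinom [simp]: "int_laurent_poly (qbinom n k)"
proof (induction n arbitrary: k)
  case 0
  show ?case by (cases k) auto
next
  case (Suc n)
  show ?case
    by (cases k) (auto simp: qbinom_Suc_Suc simp del: power_Suc
        intro!: int_laurent_poly_add int_laurent_poly_mult Suc)
qed

text \<open>Induction on \<open>M\<close>: the q-Pascal rule for \<open>qbinom (Suc M) s\<close>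
  splits the sum into the sum for \<open>R - 1\<close> and \<open>q^R\<close> times the sum for
  \<open>R\<close>, and the same rule joins them again. Truncation in \<open>M - s\<close> is
  harmless, since \<open>qbinom M s\<close> vanishes for \<open>s > M\<close>.\<close>

lemma qbinom_vandermonde:
  "qbinom (M + N) R = (\<Sum>s\<le>R. qq ^ ((M - s) * (R - s)) * qbinom M s * qbinom N (R - s))"
proof (induction M arbitrary: R)
  case 0
  have "(\<Sum>s\<le>R. qq ^ ((0 - s) * (R - s)) * qbinom 0 s * qbinom N (R - s))
      = (\<Sum>s\<in>{0}. qq ^ ((0 - s) * (R - s)) * qbinom 0 s * qbinom N (R - s))"
    by (rule sum.mono_neutral_right) auto
  thus ?case by simp
next
  case (Suc M)
  show ?case
  proof (cases R)
    case (Suc R')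
    define t where "t s = qq ^ ((Suc M - s) * (R - s)) * qbinom N (R - s)" for s
    have "(\<Sum>s\<le>R. qq ^ ((Suc M - s) * (R - s)) * qbinom (Suc M) s * qbinom N (R - s))
        = (\<Sum>s\<le>R. t s * qbinom (Suc M) s)"
      by (simp add: t_def mult_ac)
    also have "\<dots> = t 0 + (\<Sum>s\<le>R'. t (Suc s) * (qbinom M s + qq ^ Suc s * qbinom M (Suc s)))"
      unfolding Suc by (subst sum.atMost_Suc_shift) (simp add: qbinom_Suc_Suc)
    also have "\<dots> = (\<Sum>s\<le>R'. t (Suc s) * qbinom M s)
        + (t 0 + (\<Sum>s\<le>R'. t (Suc s) * qq ^ Suc s * qbinom M (Suc s)))"
      by (simp add: distrib_left sum.distrib mult_ac)
    also have "t 0 + (\<Sum>s\<le>R'. t (Suc s) * qq ^ Suc s * qbinom M (Suc s))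
        = (\<Sum>s\<le>R. t s * qq ^ s * qbinom M s)"
      unfolding Suc by (subst sum.atMost_Suc_shift) simp
    also have "(\<Sum>s\<le>R. t s * qq ^ s * qbinom M s)
        = qq ^ R * (\<Sum>s\<le>R. qq ^ ((M - s) * (R - s)) * qbinom M s * qbinom N (R - s))"
      unfolding sum_distrib_left
    proof (rule sum.cong)
      fix s assume s: "s \<in> {..R}"
      show "t s * qq ^ s * qbinom M s
          = qq ^ R * (qq ^ ((M - s) * (R - s)) * qbinom M s * qbinom N (R - s))"
      proof (cases "s \<le> M")
        case True
        hence "(Suc M - s) * (R - s) + s = R + (M - s) * (R - s)"
          using s by (simp add: Suc_diff_le)
        hence "qq ^ ((Suc M - s) * (R - s)) * qq ^ s = qq ^ R * qq ^ ((M - s) * (R - s))"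
          by (simp flip: power_add)
        thus ?thesis by (simp add: t_def mult_ac)
      qed simp
    qed simp
    also have "\<dots> = qq ^ R * qbinom (M + N) R"
      by (simp add: Suc.IH)
    also have "(\<Sum>s\<le>R'. t (Suc s) * qbinom M s) = qbinom (M + N) R'"
      unfolding Suc.IH by (intro sum.cong) (simp_all add: t_def Suc mult_ac)
    finally show ?thesis
      by (simp add: Suc qbinom_Suc_Suc del: power_Suc)
  qed simp
qed


section \<open>Linearizing products of reciprocal factorials\<close>

text \<open>This is g_x(k). The value 0 for \<open>k > x\<close> is the convention that 1/(q)_n
  vanishes for negative n; it lets summation ranges be extended or cut freely.\<close>

definition recip_qfacts :: "nat \<Rightarrow> nat \<Rightarrow> int poly fract" where
  "recip_qfacts x k = (if k \<le> x then 1 / (qfact (x - k) * qfact (x + k)) else 0)"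

lemma recip_qfacts_eq_0 [simp]: "x < k \<Longrightarrow> recip_qfacts x k = 0"
  by (simp add: recip_qfacts_def)

text \<open>Clearing the denominator \<open>D\<close> turns the product into a single Gaussian
  binomial. Both forms of q-Vandermonde fit, since they differ only in the power of q placed in
  \<open>e\<close>.\<close>

lemma recip_qfacts_mult_of_vandermonde:
  assumes "k \<le> x" "k \<le> y"
    and vandermonde: "qbinom (x + y) (y - k)
          = (\<Sum>l = k..y. e l * (qbinom (x - k) (l - k) * qbinom (y + k) (y - l)))"
  shows "recip_qfacts x k * recip_qfacts y k
      = (\<Sum>l = k..min x y. e l * (recip_qfacts l k / (qfact (x - l) * qfact (y - l) * qfact (x + y))))"
proof -
  define D where "D = qfact (x - k) * qfact (y + k) * qfact (x + y)"
  have D: "D \<noteq> 0" by (simp add: D_def)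
  have "D * (recip_qfacts x k * recip_qfacts y k) = qbinom (x + y) (y - k)"
    using assms(1,2) by (simp add: D_def recip_qfacts_def qbinom_def field_simps)
  also have "\<dots> = (\<Sum>l = k..min x y. e l * (qbinom (x - k) (l - k) * qbinom (y + k) (y - l)))"
    unfolding vandermonde
    by (rule sum.mono_neutral_right) (use assms(1) in \<open>auto intro!: qbinom_eq_0\<close>)
  also have "\<dots> = (\<Sum>l = k..min x y. D * (e l *
      (recip_qfacts l k / (qfact (x - l) * qfact (y - l) * qfact (x + y)))))"
  proof (rule sum.cong)
    fix l assume l: "l \<in> {k..min x y}"
    hence "x - k - (l - k) = x - l" "y + k - (y - l) = l + k" "l - k \<le> x - k" "y - l \<le> y + k"
      by auto
    thus "e l * (qbinom (x - k) (l - k) * qbinom (y + k) (y - l))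
        = D * (e l * (recip_qfacts l k / (qfact (x - l) * qfact (y - l) * qfact (x + y))))"
      using l by (simp add: D_def recip_qfacts_def qbinom_def field_simps)
  qed simp
  also have "\<dots> = D * (\<Sum>l = k..min x y. e l *
      (recip_qfacts l k / (qfact (x - l) * qfact (y - l) * qfact (x + y))))"
    by (simp add: sum_distrib_left)
  finally show ?thesis using D by simp
qed

text \<open>Split x + y as (x-k) + (y+k) and put l = s + k: the exponent (x-k-s)(y-k-s) becomes
  (x-l)(y-l), free of k. Terms with l < k vanish, so the range may start at any \<open>b\<close> up
  to k; a range independent of k permits the later interchange of sums.\<close>

lemma recip_qfacts_mult:
  assumes "b \<le> k"
  shows "recip_qfacts x k * recip_qfacts y k
      = (\<Sum>l = b..min x y. qq ^ ((x - l) * (y - l)) *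
           (recip_qfacts l k / (qfact (x - l) * qfact (y - l) * qfact (x + y))))"
proof (cases "k \<le> x \<and> k \<le> y")
  case True
  have "qbinom (x + y) (y - k) = qbinom ((x - k) + (y + k)) (y - k)"
    using True by simp
  also have "\<dots> = (\<Sum>s\<le>y - k. qq ^ ((x - k - s) * (y - k - s)) *
      qbinom (x - k) s * qbinom (y + k) (y - k - s))"
    by (rule qbinom_vandermonde)
  also have "\<dots> = (\<Sum>l = k..y. qq ^ ((x - l) * (y - l)) *
      (qbinom (x - k) (l - k) * qbinom (y + k) (y - l)))"
    by (rule sum.reindex_bij_witness[of _ "\<lambda>l. l - k" "\<lambda>s. s + k"])
      (use True in \<open>auto simp: mult_ac add.commute\<close>)
  finally have "recip_qfacts x k * recip_qfacts y k
      = (\<Sum>l = k..min x y. qq ^ ((x - l) * (y - l)) *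
           (recip_qfacts l k / (qfact (x - l) * qfact (y - l) * qfact (x + y))))"
    using True by (intro recip_qfacts_mult_of_vandermonde) auto
  also have "\<dots> = (\<Sum>l = b..min x y. qq ^ ((x - l) * (y - l)) *
           (recip_qfacts l k / (qfact (x - l) * qfact (y - l) * qfact (x + y))))"
    by (rule sum.mono_neutral_left) (use assms in auto)
  finally show ?thesis .
qed (auto simp: not_le intro!: sum.neutral)

text \<open>With the two summands in the other order and l = y - s, the exponent is (l+k)(l-k) = l^2
  - k^2, and the extra factor q^(k^2) removes its dependence on k.\<close>

lemma recip_qfacts_mult_square:
  assumes "b \<le> k"
  shows "qq ^ k\<^sup>2 * (recip_qfacts x k * recip_qfacts y k)
      = (\<Sum>l = b..min x y. qq ^ l\<^sup>2 *
           (recip_qfacts l k / (qfact (x - l) * qfact (y - l) * qfact (x + y))))"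
proof (cases "k \<le> x \<and> k \<le> y")
  case True
  have "qbinom (x + y) (y - k) = qbinom ((y + k) + (x - k)) (y - k)"
    using True by (simp add: add.commute)
  also have "\<dots> = (\<Sum>s\<le>y - k. qq ^ ((y + k - s) * (y - k - s)) *
      qbinom (y + k) s * qbinom (x - k) (y - k - s))"
    by (rule qbinom_vandermonde)
  also have "\<dots> = (\<Sum>l = k..y. qq ^ ((l + k) * (l - k)) *
      (qbinom (x - k) (l - k) * qbinom (y + k) (y - l)))"
    by (rule sum.reindex_bij_witness[of _ "\<lambda>l. y - l" "\<lambda>s. y - s"])
      (use True in \<open>auto simp: mult_ac add.commute\<close>)
  finally have "qq ^ k\<^sup>2 * (recip_qfacts x k * recip_qfacts y k)
      = qq ^ k\<^sup>2 * (\<Sum>l = k..min x y. qq ^ ((l + k) * (l - k)) *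
           (recip_qfacts l k / (qfact (x - l) * qfact (y - l) * qfact (x + y))))"
    using True by (subst recip_qfacts_mult_of_vandermonde) auto
  also have "\<dots> = (\<Sum>l = k..min x y. qq ^ l\<^sup>2 *
           (recip_qfacts l k / (qfact (x - l) * qfact (y - l) * qfact (x + y))))"
    unfolding sum_distrib_left
  proof (rule sum.cong)
    fix l assume "l \<in> {k..min x y}"
    then obtain d where "l = k + d" by (auto simp: le_iff_add)
    hence "k\<^sup>2 + (l + k) * (l - k) = l\<^sup>2"
      by (simp add: power2_eq_square algebra_simps)
    thus "qq ^ k\<^sup>2 * (qq ^ ((l + k) * (l - k)) *
        (recip_qfacts l k / (qfact (x - l) * qfact (y - l) * qfact (x + y))))
      = qq ^ l\<^sup>2 * (recip_qfacts l k / (qfact (x - l) * qfact (y - l) * qfact (x + y)))"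
      by (metis mult.assoc power_add)
  qed simp
  also have "\<dots> = (\<Sum>l = b..min x y. qq ^ l\<^sup>2 *
           (recip_qfacts l k / (qfact (x - l) * qfact (y - l) * qfact (x + y))))"
    by (rule sum.mono_neutral_left) (use assms in auto)
  finally show ?thesis .
qed (auto simp: not_le intro!: sum.neutral)

text \<open>One merging step that preserves the bound of j by the number of indices: while
  \<open>j <= m\<close> the first expansion keeps j, and for \<open>j = Suc m\<close> the second
  uses up one factor q^(k^2).\<close>

lemma recip_qfacts_mult_lower:
  assumes "j \<le> Suc m"
  obtains i e where "i \<le> m" "\<And>l. int_laurent_poly (e l)"
    "\<And>k. b \<le> k \<Longrightarrow> qq ^ (j * k\<^sup>2) * (recip_qfacts x k * recip_qfacts y k)
      = (\<Sum>l = b..min x y. e l * (qq ^ (i * k\<^sup>2) *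
           (recip_qfacts l k / (qfact (x - l) * qfact (y - l) * qfact (x + y)))))"
proof (cases "j \<le> m")
  case True
  show ?thesis
  proof (rule that[OF True])
    fix k assume "b \<le> k"
    show "qq ^ (j * k\<^sup>2) * (recip_qfacts x k * recip_qfacts y k)
      = (\<Sum>l = b..min x y. qq ^ ((x - l) * (y - l)) * (qq ^ (j * k\<^sup>2) *
           (recip_qfacts l k / (qfact (x - l) * qfact (y - l) * qfact (x + y)))))"
      unfolding recip_qfacts_mult[OF \<open>b \<le> k\<close>] by (simp add: sum_distrib_left mult_ac)
  qed simp
next
  case False
  hence j: "j = Suc m" using assms by simp
  show ?thesis
  proof (rule that[OF order_refl])
    fix k assume "b \<le> k"
    have "qq ^ (j * k\<^sup>2) * (recip_qfacts x k * recip_qfacts y k)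
        = qq ^ (m * k\<^sup>2) * (qq ^ k\<^sup>2 * (recip_qfacts x k * recip_qfacts y k))"
      by (simp add: j power_add mult_ac)
    thus "qq ^ (j * k\<^sup>2) * (recip_qfacts x k * recip_qfacts y k)
      = (\<Sum>l = b..min x y. qq ^ l\<^sup>2 * (qq ^ (m * k\<^sup>2) *
           (recip_qfacts l k / (qfact (x - l) * qfact (y - l) * qfact (x + y)))))"
      unfolding recip_qfacts_mult_square[OF \<open>b \<le> k\<close>] by (simp add: sum_distrib_left mult_ac)
  qed simp
qed

text \<open>The cycle of factorials (q)_{x+y} opened to a path. Dividing by the binomial and by
  [n_m+a] replaces the closing factor (q)_{n_m+n_1} by (q)_{n_1-a} (q)_{n_m+a} / [n_m+a], which
  yields the end factor (q)_{n_m+a-1}.\<close>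

fun chain_qfact :: "nat \<Rightarrow> nat list \<Rightarrow> int poly fract" where
  "chain_qfact a [] = 1"
| "chain_qfact a [x] = qfact (x + a - 1)"
| "chain_qfact a (x # y # zs) = qfact (x + y) * chain_qfact a (y # zs)"

lemma chain_qfact_neq_0 [simp]: "chain_qfact a xs \<noteq> 0"
  by (induction a xs rule: chain_qfact.induct) auto

text \<open>Replacing the head y by l changes only the first factor of the chain, so the ratio is
  one Gaussian binomial. In the singleton case \<open>0 < l\<close> keeps \<open>l + a - 1\<close>
  from being truncated.\<close>

lemma int_laurent_poly_chain_qfact_ratio:
  assumes "0 < l" "l \<le> y"
  shows "int_laurent_poly (chain_qfact a (y # zs) / (qfact (y - l) * chain_qfact a (l # zs)))"
proof (cases zs)
  case Nil
  have "chain_qfact a (y # zs) / (qfact (y - l) * chain_qfact a (l # zs))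
      = qbinom (y + a - 1) (l + a - 1)"
    using assms by (simp add: Nil qbinom_def mult_ac)
  thus ?thesis by simp
next
  case (Cons z zs')
  have "chain_qfact a (y # zs) / (qfact (y - l) * chain_qfact a (l # zs)) = qbinom (y + z) (l + z)"
    using assms by (simp add: Cons qbinom_def mult_ac)
  thus ?thesis by simp
qed

section \<open>The weighted sums\<close>

text \<open>The power q^(-(r+1)k) is shared out, one q^(-k) for [2k] and one for each [k]^2, so that
  raising r is a single multiplication.\<close>

definition moment_weight :: "nat \<Rightarrow> nat \<Rightarrow> int poly fract" where
  "moment_weight r k = qint (2 * k) * qq powi (- int k) * ((qint k)\<^sup>2 * qq powi (- int k)) ^ r"

lemma moment_weight_Suc:
  "moment_weight (Suc r) k = (qint k)\<^sup>2 * qq powi (- int k) * moment_weight r k"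
  by (simp add: moment_weight_def mult_ac)

lemma qint_square_shift:
  assumes "k \<le> n"
  shows "(qint k)\<^sup>2 * qq powi (- int k)
      = qq powi (- int n) * ((qint n)\<^sup>2 - qint (n + k) * qint (n - k))"
proof -
  obtain d where d: "n = k + d" using assms by (auto simp: le_iff_add)
  show ?thesis
    unfolding power_int_minus power_int_of_nat
    by (simp add: d qint_def divide_simps power2_eq_square power_add)
      (simp add: algebra_simps)
qed

text \<open>The two q-integers cancel the top factors of both factorials, which lowers n by one. At
  k = n both sides are 0.\<close>

lemma qint_mult_recip_qfacts:
  assumes "0 < n" "k \<le> n"
  shows "qint (n + k) * qint (n - k) * recip_qfacts n k = recip_qfacts (n - 1) k / (1 - qq)\<^sup>2"
proof (cases "k = n")
  case False
  hence "k < n" using assms(2) by simp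
  have "n + k - 1 = n - 1 + k" "n - k - 1 = n - 1 - k" using assms(1) by auto
  thus ?thesis
    using \<open>k < n\<close> qfact_rec[of "n + k"] qfact_rec[of "n - k"]
    by (simp add: recip_qfacts_def power2_eq_square qint_eq_0_iff)
qed (use assms in auto)

lemma moment_sum_0:
  assumes "0 < b" "b \<le> n" "j \<le> 1"
  shows "(1 - qq) * qfact (n - b) * qfact (n + b - 1) *
      (\<Sum>k = b..n. moment_weight 0 k * qq ^ (j * k\<^sup>2) * recip_qfacts n k)
    = (if j = 0 then qq powi (- int n) else qq ^ (b\<^sup>2 - b))"
proof -
  \<comment> \<open>Chosen so that (1 - q^(n+k)) c(k) - (1 - q^(n-k)) c(k+1) equals q^(jk^2-k) (1 -
    q^(2k)); for both values of j the terms containing n cancel.\<close>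
  define c where "c k = (if j = 0 then qq powi (- int n) else qq ^ (k\<^sup>2 - k))" for k
  \<comment> \<open>The value 0 beyond n makes the upper boundary term of the telescoping sum
    vanish.\<close>
  define t where "t k = (if k \<le> n then c k / (qfact (n - k) * qfact (n + k - 1)) else 0)" for k
  have "(1 - qq) * (\<Sum>k = b..n. moment_weight 0 k * qq ^ (j * k\<^sup>2) * recip_qfacts n k)
      = (\<Sum>k = b..n. t k - t (Suc k))"
    unfolding sum_distrib_left
  proof (rule sum.cong)
    fix k assume k: "k \<in> {b..n}"
    hence "0 < k" using assms by auto
    have S: "qfact (n + k) = qfact (n + k - 1) * (1 - qq ^ (n + k))"
      using qfact_Suc[of "n + k - 1"] \<open>0 < k\<close> by simp
    have t: "t k = (1 - qq ^ (n + k)) * c k * recip_qfacts n k"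
      using k \<open>0 < k\<close> by (simp add: t_def recip_qfacts_def S)
    have t': "t (Suc k) = (1 - qq ^ (n - k)) * c (Suc k) * recip_qfacts n k"
    proof (cases "k = n")
      case False
      then obtain d where d: "n = Suc (k + d)"
        using k less_imp_Suc_add le_neq_implies_less by (metis atLeastAtMost_iff)
      have "1 - qq ^ Suc d \<noteq> 0" by (simp del: power_Suc)
      moreover have "n - k = Suc d" "n - Suc k = d" "k \<le> n" "Suc k \<le> n" by (auto simp: d)
      ultimately show ?thesis
        by (simp add: t_def recip_qfacts_def qfact_Suc field_simps del: power_Suc)
    qed (simp add: t_def)
    have key: "(1 - qq) * (moment_weight 0 k * qq ^ (j * k\<^sup>2))
        = (1 - qq ^ (n + k)) * c k - (1 - qq ^ (n - k)) * c (Suc k)"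
    proof -
      obtain d where d: "n = k + d" using k by (auto simp: le_iff_add)
      have sq: "k\<^sup>2 = (k\<^sup>2 - k) + k" "(Suc k)\<^sup>2 - Suc k = (k\<^sup>2 - k) + 2 * k"
        by (simp_all add: power2_eq_square)
      have "j = 0 \<or> j = 1" using assms by auto
      thus ?thesis
      proof
        assume "j = 0"
        thus ?thesis
          unfolding c_def moment_weight_def power_int_minus power_int_of_nat
          by (simp add: qint_def d divide_simps power_add mult_2) (simp add: algebra_simps)
      next
        assume "j = 1"
        have "qq ^ k\<^sup>2 = qq ^ (k\<^sup>2 - k) * qq ^ k"
          using sq(1) by (metis power_add)
        thus ?thesis using \<open>j = 1\<close>
          unfolding c_def sq(2) moment_weight_def power_int_minus power_int_of_nat
          by (simp add: qint_def d divide_simps power_add mult_2) (simp add: algebra_simps)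
      qed
    qed
    have "(1 - qq) * (moment_weight 0 k * qq ^ (j * k\<^sup>2) * recip_qfacts n k)
        = (1 - qq) * (moment_weight 0 k * qq ^ (j * k\<^sup>2)) * recip_qfacts n k"
      by (simp only: mult.assoc)
    thus "(1 - qq) * (moment_weight 0 k * qq ^ (j * k\<^sup>2) * recip_qfacts n k) = t k - t (Suc k)"
      unfolding key t t' by (simp only: left_diff_distrib)
  qed simp
  also have "\<dots> = t b - t (Suc n)"
    using sum_Suc_diff[of b n "\<lambda>k. - t k"] assms by simp
  also have "\<dots> = c b / (qfact (n - b) * qfact (n + b - 1))"
    using assms by (simp add: t_def)
  finally show ?thesis
    by (simp add: c_def field_simps)
qed

text \<open>Writing E_r(n) for the expression, the square shift gives E_{r+1}(n) = q^(-n) ([n]^2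
  E_r(n) - [n-b][n+b-1] E_r(n-1)), so n must vary in the induction.\<close>

lemma int_laurent_poly_moment_sum_single:
  assumes "0 < b" "b \<le> n" "j \<le> 1"
  shows "int_laurent_poly ((1 - qq) * qfact (n - b) * qfact (n + b - 1) *
      (\<Sum>k = b..n. moment_weight r k * qq ^ (j * k\<^sup>2) * recip_qfacts n k))"
  using assms(2)
proof (induction r arbitrary: n)
  case 0
  show ?case unfolding moment_sum_0[OF assms(1) 0 assms(3)] by simp
next
  case (Suc r)
  define S where "S n = (\<Sum>k = b..n. moment_weight r k * qq ^ (j * k\<^sup>2) * recip_qfacts n k)" for n
  define E where "E n = (1 - qq) * qfact (n - b) * qfact (n + b - 1) * S n" for n
  have "0 < n" using assms(1) Suc.prems by simp
  have "(\<Sum>k = b..n. moment_weight (Suc r) k * qq ^ (j * k\<^sup>2) * recip_qfacts n k)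
      = (\<Sum>k = b..n. qq powi (- int n) * ((qint n)\<^sup>2 *
            (moment_weight r k * qq ^ (j * k\<^sup>2) * recip_qfacts n k)
          - moment_weight r k * qq ^ (j * k\<^sup>2) * recip_qfacts (n - 1) k / (1 - qq)\<^sup>2))"
  proof (rule sum.cong)
    fix k assume "k \<in> {b..n}"
    hence k: "k \<le> n" by simp
    have "moment_weight (Suc r) k * qq ^ (j * k\<^sup>2) * recip_qfacts n k
      = qq powi (- int n) * ((qint n)\<^sup>2 * (moment_weight r k * qq ^ (j * k\<^sup>2) * recip_qfacts n k)
          - moment_weight r k * qq ^ (j * k\<^sup>2) * (qint (n + k) * qint (n - k) * recip_qfacts n k))"
      unfolding moment_weight_Suc qint_square_shift[OF k] by (simp add: algebra_simps)
    thus "moment_weight (Suc r) k * qq ^ (j * k\<^sup>2) * recip_qfacts n k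
      = qq powi (- int n) * ((qint n)\<^sup>2 * (moment_weight r k * qq ^ (j * k\<^sup>2) * recip_qfacts n k)
          - moment_weight r k * qq ^ (j * k\<^sup>2) * recip_qfacts (n - 1) k / (1 - qq)\<^sup>2)"
      unfolding qint_mult_recip_qfacts[OF \<open>0 < n\<close> k] by simp
  qed simp
  also have "\<dots> = qq powi (- int n) * ((qint n)\<^sup>2 * S n
      - (\<Sum>k = b..n. moment_weight r k * qq ^ (j * k\<^sup>2) * recip_qfacts (n - 1) k) / (1 - qq)\<^sup>2)"
    by (simp add: S_def sum_subtractf right_diff_distrib flip: sum_distrib_left sum_divide_distrib)
  also have "(\<Sum>k = b..n. moment_weight r k * qq ^ (j * k\<^sup>2) * recip_qfacts (n - 1) k) = S (n - 1)"
    unfolding S_def by (rule sum.mono_neutral_right) (use \<open>0 < n\<close> in auto)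
  finally have sum_eq: "(\<Sum>k = b..n. moment_weight (Suc r) k * qq ^ (j * k\<^sup>2) * recip_qfacts n k)
      = qq powi (- int n) * ((qint n)\<^sup>2 * S n - S (n - 1) / (1 - qq)\<^sup>2)" .
  have "(1 - qq) * qfact (n - b) * qfact (n + b - 1) *
      (\<Sum>k = b..n. moment_weight (Suc r) k * qq ^ (j * k\<^sup>2) * recip_qfacts n k)
    = qq powi (- int n) * ((qint n)\<^sup>2 * E n
        - qfact (n - b) * qfact (n + b - 1) * S (n - 1) / (1 - qq))"
    unfolding sum_eq E_def by (simp add: divide_simps power2_eq_square) (simp add: algebra_simps)
  moreover have "qfact (n - b) * qfact (n + b - 1) * S (n - 1) / (1 - qq)
      = qint (n - b) * qint (n + b - 1) * E (n - 1)"
  proof (cases "n = b")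
    case True
    thus ?thesis using assms(1) by (simp add: S_def)
  next
    case False
    then obtain d where d: "n = Suc (b + d)"
      using Suc.prems less_imp_Suc_add le_neq_implies_less by metis
    have "n - b = Suc d" "n - 1 - b = d" "n + b - 1 = Suc (n - 1 + b - 1)"
      using assms(1) by (auto simp: d)
    thus ?thesis
      by (simp add: E_def qint_def qfact_Suc divide_simps del: power_Suc)
  qed
  moreover have "int_laurent_poly (E n)"
    unfolding E_def S_def by (rule Suc.IH[OF Suc.prems])
  moreover have "int_laurent_poly (qint (n - b) * qint (n + b - 1) * E (n - 1))"
  \<comment> \<open>At n = b the induction hypothesis does not reach n - 1, but there [n-b] = [0] =
    0.\<close>
  proof (cases "n = b")
    case False
    hence "int_laurent_poly (E (n - 1))"
      unfolding E_def S_def using Suc.prems by (intro Suc.IH) auto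
    thus ?thesis by (intro int_laurent_poly_mult) auto
  qed simp
  ultimately show ?case
    by (auto simp: power2_eq_square intro!: int_laurent_poly_mult int_laurent_poly_diff)
qed

text \<open>
  The summand at \<open>k = 0\<close> vanishes, so the sum may start at \<open>max a 1\<close>; this keeps all
  truncated subtractions, in particular the one in \<^const>\<open>chain_qfact\<close>, away from negative values.
\<close>

lemma int_laurent_poly_moment_sum:
  assumes "\<forall>z \<in> set (x # ys). 0 < z" "a \<le> x" "j \<le> length (x # ys)"
  shows "int_laurent_poly ((1 - qq) * qfact (x - a) * chain_qfact a (x # ys) *
      (\<Sum>k = max a 1..x. moment_weight r k * qq ^ (j * k\<^sup>2) *
          (recip_qfacts x k * (\<Prod>z\<leftarrow>ys. recip_qfacts z k))))"
  using assms
proof (induction ys arbitrary: x j)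
  case Nil
  \<comment> \<open>For a = 0 the passage to \<open>max a 1\<close> merely swaps the two
    factorials.\<close>
  have "qfact (x - a) * qfact (x + a - 1) = qfact (x - max a 1) * qfact (x + max a 1 - 1)"
    by (cases a) auto
  thus ?case
    using int_laurent_poly_moment_sum_single[of "max a 1" x j r] Nil by (simp add: mult.assoc)
next
  case (Cons y zs)
  define b where "b = max a 1"
  define P where "P k = (\<Prod>z\<leftarrow>zs. recip_qfacts z k)" for k
  obtain i e where i: "i \<le> length (y # zs)" and e: "\<And>l. int_laurent_poly (e l)"
    and lower: "\<And>k. b \<le> k \<Longrightarrow> qq ^ (j * k\<^sup>2) * (recip_qfacts x k * recip_qfacts y k)
      = (\<Sum>l = b..min x y. e l * (qq ^ (i * k\<^sup>2) *
           (recip_qfacts l k / (qfact (x - l) * qfact (y - l) * qfact (x + y)))))"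
    using recip_qfacts_mult_lower[of j "length (y # zs)" b x y] Cons.prems(3) by auto
  define S where "S l = (\<Sum>k = b..l. moment_weight r k * qq ^ (i * k\<^sup>2) * (recip_qfacts l k * P k))" for l
  have "(\<Sum>k = b..x. moment_weight r k * qq ^ (j * k\<^sup>2) * (recip_qfacts x k * (recip_qfacts y k * P k)))
      = (\<Sum>k = b..x. \<Sum>l = b..min x y. e l / (qfact (x - l) * qfact (y - l) * qfact (x + y)) *
          (moment_weight r k * qq ^ (i * k\<^sup>2) * (recip_qfacts l k * P k)))"
  proof (rule sum.cong)
    fix k assume "k \<in> {b..x}"
    have "moment_weight r k * qq ^ (j * k\<^sup>2) * (recip_qfacts x k * (recip_qfacts y k * P k))
        = moment_weight r k * P k * (qq ^ (j * k\<^sup>2) * (recip_qfacts x k * recip_qfacts y k))"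
      by (simp add: mult_ac)
    also have "qq ^ (j * k\<^sup>2) * (recip_qfacts x k * recip_qfacts y k)
      = (\<Sum>l = b..min x y. e l * (qq ^ (i * k\<^sup>2) *
           (recip_qfacts l k / (qfact (x - l) * qfact (y - l) * qfact (x + y)))))"
      by (rule lower) (use \<open>k \<in> {b..x}\<close> in simp)
    finally show "moment_weight r k * qq ^ (j * k\<^sup>2) * (recip_qfacts x k * (recip_qfacts y k * P k))
        = (\<Sum>l = b..min x y. e l / (qfact (x - l) * qfact (y - l) * qfact (x + y)) *
          (moment_weight r k * qq ^ (i * k\<^sup>2) * (recip_qfacts l k * P k)))"
      by (simp add: sum_distrib_left mult_ac)
  qed simp
  also have "\<dots> = (\<Sum>l = b..min x y. \<Sum>k = b..x. e l / (qfact (x - l) * qfact (y - l) * qfact (x + y)) *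
          (moment_weight r k * qq ^ (i * k\<^sup>2) * (recip_qfacts l k * P k)))"
    by (rule sum.swap)
  also have "\<dots> = (\<Sum>l = b..min x y. e l / (qfact (x - l) * qfact (y - l) * qfact (x + y)) * S l)"
  proof (rule sum.cong)
    fix l assume l: "l \<in> {b..min x y}"
    \<comment> \<open>The inner sum may stop at l because g_l(k) = 0 for k > l.\<close>
    have "S l = (\<Sum>k = b..x. moment_weight r k * qq ^ (i * k\<^sup>2) * (recip_qfacts l k * P k))"
      unfolding S_def by (rule sum.mono_neutral_left) (use l in auto)
    thus "(\<Sum>k = b..x. e l / (qfact (x - l) * qfact (y - l) * qfact (x + y)) *
          (moment_weight r k * qq ^ (i * k\<^sup>2) * (recip_qfacts l k * P k)))
        = e l / (qfact (x - l) * qfact (y - l) * qfact (x + y)) * S l"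
      by (simp add: sum_distrib_left)
  qed simp
  finally have sum_eq: "(\<Sum>k = b..x. moment_weight r k * qq ^ (j * k\<^sup>2) *
        (recip_qfacts x k * (recip_qfacts y k * P k)))
      = (\<Sum>l = b..min x y. e l / (qfact (x - l) * qfact (y - l) * qfact (x + y)) * S l)" .
  \<comment> \<open>The factor (q)_{x+y} cancels the head of the chain. Inserting (q)_{l-a} and the
    chain of \<open>l # zs\<close> leaves two Gaussian binomials and the expression of the induction
    hypothesis for \<open>l # zs\<close> and \<open>i\<close>.\<close>
  have "(1 - qq) * qfact (x - a) * chain_qfact a (x # y # zs) *
      (\<Sum>k = b..x. moment_weight r k * qq ^ (j * k\<^sup>2) *
          (recip_qfacts x k * (recip_qfacts y k * P k)))
    = (\<Sum>l = b..min x y. e l * qbinom (x - a) (l - a) *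
        (chain_qfact a (y # zs) / (qfact (y - l) * chain_qfact a (l # zs))) *
        ((1 - qq) * qfact (l - a) * chain_qfact a (l # zs) * S l))"
    unfolding sum_eq sum_distrib_left
  proof (rule sum.cong)
    fix l assume "l \<in> {b..min x y}"
    hence l: "a \<le> l" "l \<le> x" by (auto simp: b_def)
    hence "x - a - (l - a) = x - l" by simp
    thus "(1 - qq) * qfact (x - a) * chain_qfact a (x # y # zs) *
        (e l / (qfact (x - l) * qfact (y - l) * qfact (x + y)) * S l)
      = e l * qbinom (x - a) (l - a) *
        (chain_qfact a (y # zs) / (qfact (y - l) * chain_qfact a (l # zs))) *
        ((1 - qq) * qfact (l - a) * chain_qfact a (l # zs) * S l)"
      using l by (simp add: qbinom_def)
  qed simp
  also have "int_laurent_poly \<dots>"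
  proof (rule int_laurent_poly_sum)
    fix l assume l: "l \<in> {b..min x y}"
    hence "0 < l" "l \<le> y" "a \<le> l" by (auto simp: b_def)
    have "int_laurent_poly ((1 - qq) * qfact (l - a) * chain_qfact a (l # zs) * S l)"
      unfolding S_def P_def b_def
      by (rule Cons.IH) (use Cons.prems i \<open>0 < l\<close> \<open>a \<le> l\<close> in auto)
    thus "int_laurent_poly (e l * qbinom (x - a) (l - a) *
        (chain_qfact a (y # zs) / (qfact (y - l) * chain_qfact a (l # zs))) *
        ((1 - qq) * qfact (l - a) * chain_qfact a (l # zs) * S l))"
      by (rule int_laurent_poly_mult[OF int_laurent_poly_mult[OF
              int_laurent_poly_mult[OF e int_laurent_poly_qbinom]
              int_laurent_poly_chain_qfact_ratio[OF \<open>0 < l\<close> \<open>l \<le> y\<close>]]])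
  qed
  finally show ?case by (simp add: P_def b_def)
qed

section \<open>From the cyclic product of binomials to the chain\<close>

lemma chain_qfact_map_upt:
  "chain_qfact a (map n [p..<Suc (p + d)]) = (\<Prod>i = p..<p + d. qfact (n i + n (Suc i))) * qfact (n (p + d) + a - 1)"
proof (induction d arbitrary: p)
  case (Suc d)
  have "map n [p..<Suc (p + Suc d)] = n p # n (Suc p) # map n [Suc (Suc p)..<Suc (Suc p + d)]"
    by (simp add: upt_conv_Cons del: upt_Suc)
  moreover have "n (Suc p) # map n [Suc (Suc p)..<Suc (Suc p + d)] = map n [Suc p..<Suc (Suc p + d)]"
    by (simp add: upt_conv_Cons del: upt_Suc)
  ultimately have "chain_qfact a (map n [p..<Suc (p + Suc d)])
      = qfact (n p + n (Suc p)) * chain_qfact a (map n [Suc p..<Suc (Suc p + d)])"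
    by (metis chain_qfact.simps(3))
  thus ?case
    unfolding Suc.IH by (simp add: prod.atLeast_Suc_lessThan[of p] mult.assoc del: upt_Suc)
qed simp

text \<open>The i-th binomial contributes 1/(q)_{n_i+k} and 1/(q)_{n_{i+1}-k}; shifting the latter
  once around the cycle pairs both at the same index.\<close>

lemma qbinom_cyclic_prod:
  assumes "n (Suc m) = n 1"
  shows "(\<Prod>i = 1..m. qbinom (n i + n (Suc i)) (n i + k))
      = (\<Prod>i = 1..m. qfact (n i + n (Suc i))) * (\<Prod>i = 1..m. recip_qfacts (n i) k)"
proof -
  define h where "h x = (if k \<le> x then 1 / qfact (x - k) else 0)" for x
  have "(\<Prod>i = 1..m. h (n (Suc i))) * h (n 1) = (\<Prod>i = 1..m. h (n i)) * h (n (Suc m))"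
  proof (induction m)
    case (Suc m)
    thus ?case by (simp add: mult_ac)
  qed simp
  hence shift: "(\<Prod>i = 1..m. h (n (Suc i))) = (\<Prod>i = 1..m. h (n i))"
  \<comment> \<open>Where \<open>h (n 1)\<close> is 0 it cannot be cancelled, but it then occurs in
    both products, at i = m on the left and at i = 1 on the right.\<close>
  proof (cases "h (n 1) = 0 \<and> m > 0")
    case True
    hence "h (n 1) = 0" "h (n (Suc m)) = 0" "1 \<in> {1..m}" "m \<in> {1..m}"
      using assms by auto
    hence "(\<Prod>i = 1..m. h (n (Suc i))) = 0" "(\<Prod>i = 1..m. h (n i)) = 0"
      by (auto intro!: prod_zero)
    thus ?thesis by (simp only:)
  qed (auto simp: assms)
  have "(\<Prod>i = 1..m. qbinom (n i + n (Suc i)) (n i + k))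
      = (\<Prod>i = 1..m. qfact (n i + n (Suc i)) * (1 / qfact (n i + k)) * h (n (Suc i)))"
    by (intro prod.cong) (auto simp: qbinom_def h_def)
  also have "\<dots> = (\<Prod>i = 1..m. qfact (n i + n (Suc i))) *
      ((\<Prod>i = 1..m. 1 / qfact (n i + k)) * (\<Prod>i = 1..m. h (n i)))"
    by (simp only: prod.distrib shift mult.assoc)
  also have "(\<Prod>i = 1..m. 1 / qfact (n i + k)) * (\<Prod>i = 1..m. h (n i)) = (\<Prod>i = 1..m. recip_qfacts (n i) k)"
    unfolding prod.distrib[symmetric]
    by (intro prod.cong) (auto simp: h_def recip_qfacts_def)
  finally show ?thesis .
qed

lemma moment_weight_expand:
  "qint (2 * k) * qint k ^ (2 * r) * qq powi (int j * (int k)\<^sup>2 - (int r + 1) * int k)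
    = moment_weight r k * qq ^ (j * k\<^sup>2)"
proof -
  have "qq powi (int j * (int k)\<^sup>2 - (int r + 1) * int k)
      = qq powi (int (j * k\<^sup>2) + - int k + - int k * int r)"
    by (rule arg_cong[where f = "power_int qq"]) (simp add: algebra_simps)
  also have "\<dots> = qq ^ (j * k\<^sup>2) * qq powi (- int k) * (qq powi (- int k)) ^ r"
    by (simp only: power_int_add[OF disjI1[OF qq_neq_0]] power_int_mult power_int_of_nat)
  finally show ?thesis
    unfolding moment_weight_def power_mult_distrib power_mult[of "qint k" 2 r]
    by (simp only: mult_ac)
qed

theorem theorem4p2:
  fixes m a j r :: nat and n :: "nat \<Rightarrow> nat"
  assumes "m > 0"
    and "\<And>i. 1 \<le> i \<Longrightarrow> i \<le> m \<Longrightarrow> n i > 0"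
    and "n (m + 1) = n 1"
    and "a \<le> n 1"
    and "j \<le> m"
  shows "int_laurent_poly
    (1 / qint (n m + a) * inverse (qbinom (n 1 + n m) (n 1 - a)) *
      (\<Sum>k = a..n 1. qint (2 * k) * qint k ^ (2 * r)
         * qq powi (int j * (int k)\<^sup>2 - (int r + 1) * int k)
         * (\<Prod>i = 1..m. qbinom (n i + n (i + 1)) (n i + k))))"
proof -
  obtain d where m: "m = Suc d" using assms(1) by (cases m) auto
  define ys where "ys = map n [2..<Suc m]"
  define C where "C = (\<Prod>i = 1..<m. qfact (n i + n (Suc i)))"
  define S where "S = (\<Sum>k = max a 1..n 1. moment_weight r k * qq ^ (j * k\<^sup>2) *
      (recip_qfacts (n 1) k * (\<Prod>z\<leftarrow>ys. recip_qfacts z k)))"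
  have ys: "n 1 # ys = map n [1..<Suc m]"
    using assms(1) by (simp add: ys_def upt_conv_Cons numeral_2_eq_2 del: upt_Suc)
  have chain: "chain_qfact a (n 1 # ys) = C * qfact (n m + a - 1)"
    using chain_qfact_map_upt[of a n 1 d] unfolding ys by (simp add: C_def m del: upt_Suc)
  have prod_list_eq: "recip_qfacts (n 1) k * (\<Prod>z\<leftarrow>ys. recip_qfacts z k) = (\<Prod>i = 1..m. recip_qfacts (n i) k)" for k
  proof -
    have "recip_qfacts (n 1) k * (\<Prod>z\<leftarrow>ys. recip_qfacts z k) = (\<Prod>z\<leftarrow>n 1 # ys. recip_qfacts z k)"
      by simp
    also have "\<dots> = (\<Prod>i\<leftarrow>[1..<Suc m]. recip_qfacts (n i) k)"
      unfolding ys by (simp add: o_def del: upt_Suc)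
    also have "\<dots> = (\<Prod>i = 1..m. recip_qfacts (n i) k)"
      by (subst prod.distinct_set_conv_list[symmetric])
        (auto simp del: upt_Suc simp: atLeastLessThanSuc_atLeastAtMost)
    finally show ?thesis .
  qed
  \<comment> \<open>The factor at i = m closes the cycle and is kept apart, to cancel against the
    binomial.\<close>
  have "(\<Prod>i = 1..m. qfact (n i + n (Suc i))) = C * qfact (n 1 + n m)"
    using assms(3) by (simp add: C_def m atLeastLessThanSuc_atLeastAtMost add.commute)
  hence "(\<Sum>k = a..n 1. qint (2 * k) * qint k ^ (2 * r)
         * qq powi (int j * (int k)\<^sup>2 - (int r + 1) * int k)
         * (\<Prod>i = 1..m. qbinom (n i + n (i + 1)) (n i + k)))
      = C * qfact (n 1 + n m) * (\<Sum>k = a..n 1. moment_weight r k * qq ^ (j * k\<^sup>2) *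
          (recip_qfacts (n 1) k * (\<Prod>z\<leftarrow>ys. recip_qfacts z k)))"
    using qbinom_cyclic_prod[of n m] assms(3) unfolding moment_weight_expand prod_list_eq
    by (simp add: sum_distrib_left mult_ac)
  also have "(\<Sum>k = a..n 1. moment_weight r k * qq ^ (j * k\<^sup>2) *
          (recip_qfacts (n 1) k * (\<Prod>z\<leftarrow>ys. recip_qfacts z k))) = S"
    unfolding S_def
    by (rule sum.mono_neutral_right) (auto simp: moment_weight_def not_le less_Suc_eq)
  finally have "1 / qint (n m + a) * inverse (qbinom (n 1 + n m) (n 1 - a)) *
      (\<Sum>k = a..n 1. qint (2 * k) * qint k ^ (2 * r)
         * qq powi (int j * (int k)\<^sup>2 - (int r + 1) * int k)
         * (\<Prod>i = 1..m. qbinom (n i + n (i + 1)) (n i + k)))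
      = 1 / qint (n m + a) * inverse (qbinom (n 1 + n m) (n 1 - a)) * (C * qfact (n 1 + n m) * S)"
    by simp
  also have "\<dots> = (1 - qq) * qfact (n 1 - a) * chain_qfact a (n 1 # ys) * S"
  proof -
    have "0 < n m" using assms(1,2) by simp
    hence rec: "qfact (n m + a) = qfact (n m + a - 1) * ((1 - qq) * qint (n m + a))"
      and nz: "qint (n m + a) \<noteq> 0"
      using qfact_rec[of "n m + a"] by (simp_all add: qint_eq_0_iff)
    have "n 1 + n m - (n 1 - a) = n m + a" "n 1 - a \<le> n 1 + n m"
      using assms(4) by auto
    hence binom: "qbinom (n 1 + n m) (n 1 - a) = qfact (n 1 + n m) / (qfact (n 1 - a) * qfact (n m + a))"
      by (simp add: qbinom_def)
    show ?thesis
      unfolding binom chain rec using nz by (simp add: divide_simps)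
  qed
  also have "int_laurent_poly \<dots>"
    unfolding S_def
  proof (rule int_laurent_poly_moment_sum)
    show "\<forall>z \<in> set (n 1 # ys). 0 < z"
      unfolding ys using assms(2) by (auto simp del: upt_Suc)
    show "j \<le> length (n 1 # ys)"
      unfolding ys using assms(5) by (simp del: upt_Suc)
  qed (rule assms(4))
  finally show ?thesis .
qed

end
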